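(* Let $p$ be an odd prime and let $h\in\mathbb{Z}$ with $2h-1\equiv 0\pmod{p}$. If $a\in\mathbb{Z}^{+}$ and $p^a>3$, then \[ \sum_{k=0}^{p^a-1}\binom{hp^a-1}{k}\binom{2k}{k}\Big(-\frac{h}{2}\Big)^k\equiv 0\pmod{p^{a+1}}. \] Also, for any $n\in\mathbb{Z}^{+}$ we have \[ \nu_p\bigg(\sum_{k=0}^{n-1}\binom{hn-1}{k}\binom{2k}{k}\Big(-\frac{h}{2}\Big)^k\bigg)\geq \nu_p(n). \]
   Context: For a nonzero integer $n$, $\nu_p(n)$ denotes the $p$-adic valuation of $n$ (the largest integer $e$ with $p^e\mid n$), with $\nu_p(0)=+\infty$, and $\nu_p(m/n)=\nu_p(m)-\nu_p(n)$ for rationals. Since $p$ is odd, $2$ is invertible modulo $p$, so the sums are rational numbers that are $p$-adic integers, and congruences are understood in the ring $\mathbb{Z}_p$ of $p$-adic integers. *)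

theory Defs
  imports
    Complex_Main
    "HOL-Number_Theory.Number_Theory"
    "HOL-Library.Extended"
begin

text \<open>The library's \<open>multiplicity\<close> has value 0 at 0, hence the case distinction.
  Values live in the integers extended by \<open>Pinf\<close>.\<close>

definition nu_int :: "nat \<Rightarrow> int \<Rightarrow> int extended" where
  "nu_int p n = (if n = 0 then Pinf else Fin (int (multiplicity (int p) n)))"

text \<open>\<open>quotient_of x\<close> is the reduced fraction \<open>(m, n)\<close> with \<open>n > 0\<close> representing \<open>x\<close>;
  \<open>nu_Fract\<close> below shows that any other representation gives the same value.\<close>

definition nu :: "nat \<Rightarrow> rat \<Rightarrow> int extended" where
  "nu p x = nu_int p (fst (quotient_of x)) - nu_int p (snd (quotient_of x))"

text \<open>The rational numbers that are \<open>p\<close>-adic integers, i.e. the intersection of the rationals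
  with the ring of \<open>p\<close>-adic integers.\<close>

definition padic_integral :: "nat \<Rightarrow> rat set" where
  "padic_integral p = {x. nu p x \<ge> 0}"

text \<open>Congruence modulo \<open>p ^ m\<close> in the ring of \<open>p\<close>-adic integers, for \<open>x\<close> and \<open>y\<close> rational.
  The quotient \<open>(x - y) / p ^ m\<close> is then itself rational, so the cofactor \<open>z\<close> may be
  taken in \<open>padic_integral p\<close>.\<close>

definition padic_cong :: "nat \<Rightarrow> nat \<Rightarrow> rat \<Rightarrow> rat \<Rightarrow> bool" where
  "padic_cong p m x y \<longleftrightarrow>
     x \<in> padic_integral p \<and> y \<in> padic_integral p \<and>
     (\<exists>z\<in>padic_integral p. x - y = of_nat p ^ m * z)"

lemma nu_Fract:
  assumes "prime p" and "n \<noteq> 0"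
  shows "nu p (Fract m n) = nu_int p m - nu_int p n"
proof -
  obtain u v where uv: "quotient_of (Fract m n) = (u, v)"
    by fastforce
  have v: "v > 0" and eq: "Fract m n = Fract u v"
    using quotient_of_denom_pos[OF uv] quotient_of_div[OF uv] by (auto simp: Fract_of_int_quotient)
  have cross: "m * v = u * n"
    using eq v assms(2) by (simp add: eq_rat)
  have val: "nu p (Fract m n) = nu_int p u - nu_int p v"
    by (simp add: nu_def uv)
  have pr: "prime_elem (int p)"
    using assms(1) by simp
  show ?thesis
  proof (cases "m = 0")
    case True
    then show ?thesis
      unfolding val using cross v assms(2) by (simp add: nu_int_def)
  next
    case False
    then have "u \<noteq> 0"
      using cross v by auto
    have "multiplicity (int p) m + multiplicity (int p) v
        = multiplicity (int p) u + multiplicity (int p) n"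
      using arg_cong[OF cross, of "multiplicity (int p)"] pr False \<open>u \<noteq> 0\<close> v assms(2)
      by (simp add: prime_elem_multiplicity_mult_distrib)
    then show ?thesis
      unfolding val using False \<open>u \<noteq> 0\<close> v assms(2) by (simp add: nu_int_def)
  qed
qed

end

(* Write n = m + 1 and let L be the linear functional on polynomials in y that maps y^k to the central
   binomial coefficient C(2k,k). A partial sum identity for binomial coefficients turns 4^m times the
   sum into
     sum_k C((1-h)n, k) (2h)^k L(y^k (4 - 2hy)^(m-k)),
   and 4 - 2hy = (4 - y) - qy with q = 2h - 1 divisible by p. The numbers E(k,j) = L(y^k (4-y)^j) are
   the super Catalan numbers, with (k+j+1) E(k+1,j) = 2(2k+1) E(k,j). So a power of p dividing n divides
   (2k+2i+1) E(k+i,m-k-i); as it also divides k C((1-h)n, k), it divides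
   (2i+1) C((1-h)n, k) E(k+i,m-k-i), and the loss of 2i+1 is made up by q^i since 2i+1 < p^(i+1).

   For n = p^a the same estimate gains one more factor p when i > 0, except for p = 3 and i = 1. What
   remains is linear in x = 1 - h modulo p^(a+1), because C(xn,k) may be replaced by x C(n,k) for
   0 < k < n. Since 2x = 1 modulo p, twice the sum is congruent to its value at x = 0 plus its value at
   x = 1, and both have closed forms in terms of C(2m,m). *)

theory Submission
  imports Defs
begin

section \<open>Binomial coefficients with integer upper argument\<close>

text \<open>The library restricts the input syntax of \<open>gchoose\<close> to fields.\<close>

definition ibinom :: "int \<Rightarrow> nat \<Rightarrow> int" where
  "ibinom a k = (if 0 \<le> a then int (nat a choose k) else (- 1) ^ k * int ((k + nat (- a) - 1) choose k))"

lemmas gchoose_eq_ibinom = gbinomial_int_binomial[folded ibinom_def]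
lemmas of_int_ibinom = of_int_gbinomial[unfolded gchoose_eq_ibinom]
lemmas ibinom_negated_upper = gbinomial_int_negated_upper[unfolded gchoose_eq_ibinom]
lemmas ibinom_minus_one [simp] = uminus_one_gbinomial[unfolded gchoose_eq_ibinom]
lemmas ibinom_Suc_Suc = gbinomial_int_Suc_Suc[unfolded gchoose_eq_ibinom]
lemmas ibinom_Suc_n = gbinomial_int_Suc_n[unfolded gchoose_eq_ibinom]

lemma ibinom_0 [simp]: "ibinom a 0 = 1"
  by (simp add: ibinom_def)

lemma ibinom_absorb: "(int k + 1) * ibinom a (Suc k) = a * ibinom (a - 1) k"
proof -
  have "rat_of_int ((int k + 1) * ibinom a (Suc k)) = of_int (a * ibinom (a - 1) k)"
    using gbinomial_absorption'[of "Suc k" "rat_of_int a"]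
    by (simp add: of_int_ibinom field_simps)
  then show ?thesis by (simp only: of_int_eq_iff)
qed

section \<open>The linear functional and the partial sum identity\<close>

text \<open>\<open>mixed g c j k\<close> is the image of \<open>y ^ k * (4 - g * y) ^ j\<close> under the linear functional that maps
  \<open>y ^ i\<close> to \<open>c i\<close>.\<close>

primrec mixed :: "int \<Rightarrow> (nat \<Rightarrow> int) \<Rightarrow> nat \<Rightarrow> nat \<Rightarrow> int" where
  "mixed g c 0 k = c k"
| "mixed g c (Suc j) k = 4 * mixed g c j k - g * mixed g c j (Suc k)"

lemma mixed_shift: "mixed g (\<lambda>k. c (Suc k)) j k = mixed g c j (Suc k)"
  by (induction j arbitrary: k) auto

text \<open>Pascal's rule on the left and the recursion of \<open>mixed\<close> on the right give
  both sides the same recurrence in \<open>m\<close>: 4 times the sum for \<open>c\<close>, minus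
  \<open>g\<close> times the sum for the shifted \<open>c\<close>, plus one term at index
  \<open>Suc m\<close>. The shift is why the induction is over all \<open>c\<close>.\<close>

lemma gbinomial_partial_sum_mixed:
  "(\<Sum>k\<le>m. ibinom (int m + a) k * (- g) ^ k * c k * 4 ^ (m - k)) =
   (\<Sum>k\<le>m. ibinom (- a) k * g ^ k * mixed g c (m - k) k)"
proof (induction m arbitrary: c)
  case 0
  then show ?case by simp
next
  case (Suc m)
  let ?A = "\<lambda>k. ibinom (int m + a) k"
  let ?L = "\<lambda>c. \<Sum>k\<le>m. ?A k * (- g) ^ k * c k * 4 ^ (m - k)"
  let ?R = "\<lambda>c. \<Sum>k\<le>m. ibinom (- a) k * g ^ k * mixed g c (m - k) k"
  have pascal: "ibinom (int (Suc m) + a) (Suc k) = ?A k + ?A (Suc k)" for k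
    using ibinom_Suc_Suc[of "int m + a" k] by (simp add: algebra_simps)
  \<comment> \<open>Upper negation turns the extra term at index \<open>Suc m\<close> on the left
    into the one on the right.\<close>
  have top: "?A (Suc m) = (- 1) ^ Suc m * ibinom (- a) (Suc m)"
    by (subst ibinom_negated_upper) simp
  have "(\<Sum>k\<le>Suc m. ibinom (int (Suc m) + a) k * (- g) ^ k * c k * 4 ^ (Suc m - k))
      = 4 ^ Suc m * c 0 + (\<Sum>k\<le>m. (?A k + ?A (Suc k)) * (- g) ^ Suc k * c (Suc k) * 4 ^ (m - k))"
    by (subst sum.atMost_Suc_shift) (simp only: pascal, simp)
  also have "\<dots> = - g * ?L (\<lambda>k. c (Suc k))
      + (4 ^ Suc m * c 0 + (\<Sum>k\<le>m. ?A (Suc k) * (- g) ^ Suc k * c (Suc k) * 4 ^ (m - k)))"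
    by (simp add: sum_distrib_left sum.distrib[symmetric] algebra_simps sum_negf)
  also have "4 ^ Suc m * c 0 + (\<Sum>k\<le>m. ?A (Suc k) * (- g) ^ Suc k * c (Suc k) * 4 ^ (m - k))
      = (\<Sum>k\<le>Suc m. ?A k * (- g) ^ k * c k * 4 ^ (Suc m - k))"
    by (subst sum.atMost_Suc_shift) simp
  also have "\<dots> = 4 * ?L c + ?A (Suc m) * (- g) ^ Suc m * c (Suc m)"
    by (simp add: sum_distrib_left Suc_diff_le algebra_simps)
  also have "?A (Suc m) * (- g) ^ Suc m * c (Suc m) = ibinom (- a) (Suc m) * g ^ Suc m * c (Suc m)"
    by (simp only: top power_minus[of g]) (simp flip: power_mult_distrib)
  also have "- g * ?L (\<lambda>k. c (Suc k)) + (4 * ?L c + ibinom (- a) (Suc m) * g ^ Suc m * c (Suc m))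
     = - g * ?R (\<lambda>k. c (Suc k)) + (4 * ?R c + ibinom (- a) (Suc m) * g ^ Suc m * c (Suc m))"
    by (simp only: Suc.IH)
  also have "\<dots> = (\<Sum>k\<le>m. ibinom (- a) k * g ^ k * mixed g c (Suc (m - k)) k)
      + ibinom (- a) (Suc m) * g ^ Suc m * c (Suc m)"
    by (simp add: mixed_shift sum_distrib_left sum.distrib[symmetric] sum_subtractf algebra_simps)
  also have "\<dots> = (\<Sum>k\<le>Suc m. ibinom (- a) k * g ^ k * mixed g c (Suc m - k) k)"
    by (simp add: Suc_diff_le)
  finally show ?case .
qed

text \<open>This is the binomial theorem for 4 - g y = (4 - y) + (1 - g) y, read through the
  functional.\<close>

lemma mixed_change:
  "mixed g c j k = (\<Sum>i\<le>j. int (j choose i) * (1 - g) ^ i * mixed 1 c (j - i) (k + i))"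
proof (induction j arbitrary: k)
  case 0
  then show ?case by simp
next
  case (Suc j)
  let ?S = "\<lambda>k. \<Sum>i\<le>j. int (j choose i) * (1 - g) ^ i * mixed 1 c (j - i) (k + i)"
  have "(\<Sum>i\<le>Suc j. int (Suc j choose i) * (1 - g) ^ i * mixed 1 c (Suc j - i) (k + i))
      = mixed 1 c (Suc j) k + (\<Sum>i\<le>j. int (j choose Suc i) * (1 - g) ^ Suc i * mixed 1 c (j - i) (Suc k + i))
        + (\<Sum>i\<le>j. int (j choose i) * (1 - g) ^ Suc i * mixed 1 c (j - i) (Suc k + i))"
    by (subst sum.atMost_Suc_shift) (simp add: sum.distrib[symmetric] algebra_simps del: mixed.simps)
  also have "mixed 1 c (Suc j) k + (\<Sum>i\<le>j. int (j choose Suc i) * (1 - g) ^ Suc i * mixed 1 c (j - i) (Suc k + i))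
     = (\<Sum>i\<le>Suc j. int (j choose i) * (1 - g) ^ i * mixed 1 c (Suc j - i) (k + i))"
    by (subst sum.atMost_Suc_shift) (simp del: mixed.simps)
  also have "\<dots> = (\<Sum>i\<le>j. int (j choose i) * (1 - g) ^ i * mixed 1 c (Suc (j - i)) (k + i))"
    by (simp add: Suc_diff_le del: mixed.simps)
  also have "\<dots> = 4 * ?S k - ?S (Suc k)"
    by (simp add: sum_distrib_left sum_subtractf algebra_simps)
  also have "(\<Sum>i\<le>j. int (j choose i) * (1 - g) ^ Suc i * mixed 1 c (j - i) (Suc k + i)) = (1 - g) * ?S (Suc k)"
    by (simp add: sum_distrib_left mult_ac)
  also have "4 * ?S k - ?S (Suc k) + (1 - g) * ?S (Suc k) = mixed g c (Suc j) k"
    by (simp only: Suc.IH[symmetric] mixed.simps) (simp add: algebra_simps)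
  finally show ?case ..
qed

section \<open>Central binomial coefficients and super Catalan numbers\<close>

definition cbin :: "nat \<Rightarrow> int" where
  "cbin k = int (2 * k choose k)"

lemma cbin_Suc: "(int k + 1) * cbin (Suc k) = 2 * (2 * int k + 1) * cbin k"
proof -
  have a: "Suc k * (Suc (Suc (2 * k)) choose Suc k) = Suc (Suc (2 * k)) * (Suc (2 * k) choose k)"
    by (metis Suc_times_binomial_eq mult.commute)
  have b: "Suc k * (Suc (2 * k) choose Suc k) = Suc (2 * k) * (2 * k choose k)"
    by (metis Suc_times_binomial_eq mult.commute)
  have c: "Suc (2 * k) choose Suc k = Suc (2 * k) choose k"
    by (subst binomial_symmetric) simp_all
  have "Suc k * (Suc k * (2 * Suc k choose Suc k)) = Suc k * (2 * Suc (2 * k) * (2 * k choose k))"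
    using a b c by (simp add: algebra_simps)
  then have "Suc k * (2 * Suc k choose Suc k) = 2 * Suc (2 * k) * (2 * k choose k)"
    by (subst (asm) mult_left_cancel) auto
  from arg_cong[OF this, of int] show ?thesis
    unfolding cbin_def by (simp add: algebra_simps)
qed

text \<open>\<open>super_catalan j k = fact (2 * j) * fact (2 * k) / (fact j * fact k * fact (j + k))\<close>.\<close>

definition super_catalan :: "nat \<Rightarrow> nat \<Rightarrow> int" where
  "super_catalan j k = mixed 1 cbin j k"

lemma super_catalan_0: "super_catalan 0 k = cbin k"
  and super_catalan_Suc: "super_catalan (Suc j) k = 4 * super_catalan j k - super_catalan j (Suc k)"
  by (simp_all add: super_catalan_def)

text \<open>The factorial formula shows this ratio at once; the proof avoids division. The induction
  hypothesis and the recursion in \<open>j\<close> give the ratio in the other direction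
  (\<open>down\<close>). Using \<open>down\<close> at \<open>k\<close> and at \<open>Suc k\<close>
  and cancelling \<open>k + j + 1\<close> yields the step.\<close>

lemma super_catalan_right: "(int k + int j + 1) * super_catalan j (Suc k) = 2 * (2 * int k + 1) * super_catalan j k"
proof (induction j arbitrary: k)
  case 0
  then show ?case using cbin_Suc[of k] by (simp add: super_catalan_0)
next
  case (Suc j)
  have down: "(int k + int j + 1) * super_catalan (Suc j) k = 2 * (2 * int j + 1) * super_catalan j k" for k
    using Suc.IH[of k] unfolding super_catalan_Suc by (simp add: algebra_simps)
  have 1: "(int k + int j + 2) * super_catalan (Suc j) (Suc k) = 2 * (2 * int j + 1) * super_catalan j (Suc k)"
    using down[of "Suc k"] by (simp add: algebra_simps)
  have "(int k + int j + 1) * ((int k + int j + 2) * super_catalan (Suc j) (Suc k))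
     = 2 * (2 * int j + 1) * ((int k + int j + 1) * super_catalan j (Suc k))"
    unfolding 1 by (simp only: mult_ac)
  also have "\<dots> = 2 * (2 * int k + 1) * (2 * (2 * int j + 1) * super_catalan j k)"
    unfolding Suc.IH by (simp only: mult_ac)
  also have "\<dots> = 2 * (2 * int k + 1) * ((int k + int j + 1) * super_catalan (Suc j) k)"
    unfolding down ..
  finally have "(int k + int j + 1) * ((int k + int j + 2) * super_catalan (Suc j) (Suc k))
     = (int k + int j + 1) * (2 * (2 * int k + 1) * super_catalan (Suc j) k)"
    by (simp only: mult_ac)
  then have "(int k + int j + 2) * super_catalan (Suc j) (Suc k) = 2 * (2 * int k + 1) * super_catalan (Suc j) k"
    by (subst (asm) mult_left_cancel) auto
  then show ?case by (simp add: algebra_simps)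
qed

lemma super_catalan_left: "(int k + int j + 1) * super_catalan (Suc j) k = 2 * (2 * int j + 1) * super_catalan j k"
  using super_catalan_right[of k j] unfolding super_catalan_Suc by (simp add: algebra_simps)

lemma super_catalan_0_right: "super_catalan j 0 = cbin j"
proof (induction j)
  case (Suc j)
  have "(int j + 1) * super_catalan (Suc j) 0 = (int j + 1) * cbin (Suc j)"
    using super_catalan_left[of 0 j] cbin_Suc[of j] Suc by simp
  then show ?case by (subst (asm) mult_left_cancel) auto
qed (simp add: super_catalan_0)

section \<open>Closed forms for the values at x = 1\<close>

lemma sum_cbin: "(\<Sum>k\<le>m. cbin k * 4 ^ (m - k)) = (2 * int m + 1) * cbin m"
proof (induction m)
  case (Suc m)
  have "(\<Sum>k\<le>Suc m. cbin k * 4 ^ (Suc m - k)) = 4 * (\<Sum>k\<le>m. cbin k * 4 ^ (m - k)) + cbin (Suc m)"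
    by (simp add: Suc_diff_le sum_distrib_left mult_ac)
  then show ?case using cbin_Suc[of m] Suc by (simp add: algebra_simps)
qed (simp add: cbin_def)

lemma sum_index_cbin:
  "3 * (\<Sum>k\<le>m. (int k + 1) * cbin (Suc k) * 4 ^ (m - k)) = (int m + 1) * (2 * int m + 3) * cbin (Suc m)"
proof (induction m)
  case (Suc m)
  let ?S = "\<lambda>m. \<Sum>k\<le>m. (int k + 1) * cbin (Suc k) * 4 ^ (m - k)"
  have s: "?S (Suc m) = 4 * ?S m + (int m + 2) * cbin (Suc (Suc m))"
    by (simp add: Suc_diff_le sum_distrib_left mult_ac)
  have c: "(int m + 2) * cbin (Suc (Suc m)) = 2 * (2 * int m + 3) * cbin (Suc m)"
    using cbin_Suc[of "Suc m"] by (simp add: algebra_simps)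
  have "3 * ?S (Suc m) = 4 * ((int m + 1) * (2 * int m + 3) * cbin (Suc m)) + 3 * (int m + 2) * cbin (Suc (Suc m))"
    using Suc by (simp only: s) (simp add: algebra_simps)
  also have "\<dots> = 2 * (int m + 1) * ((int m + 2) * cbin (Suc (Suc m))) + 3 * (int m + 2) * cbin (Suc (Suc m))"
    unfolding c by (simp add: algebra_simps)
  also have "\<dots> = (int (Suc m) + 1) * (2 * int (Suc m) + 3) * cbin (Suc (Suc m))"
    by (simp add: algebra_simps)
  finally show ?case .
qed (simp add: cbin_def)

text \<open>The partial sum identity with \<open>g = 1\<close> and \<open>a = - (m + 1)\<close> has
  upper argument -1 on the left, so the binomial coefficients only cancel the signs.\<close>

lemma sum_binomial_super:
  "(\<Sum>k\<le>m. ibinom (int (Suc m)) k * super_catalan (m - k) k) = (2 * int m + 1) * cbin m"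
proof -
  have "(\<Sum>k\<le>m. ibinom (int (Suc m)) k * super_catalan (m - k) k )
      = (\<Sum>k\<le>m. ibinom (- 1) k * (- 1) ^ k * cbin k * 4 ^ (m - k))"
    using gbinomial_partial_sum_mixed[of m "- int (Suc m)" 1 cbin] by (simp add: super_catalan_def add.commute)
  also have "\<dots> = (\<Sum>k\<le>m. cbin k * 4 ^ (m - k))"
    by (simp flip: power_mult_distrib)
  finally show ?thesis by (simp add: sum_cbin)
qed

text \<open>As for \<open>sum_binomial_super\<close>, now with upper argument -2, whose binomial
  coefficients are \<open>k + 1\<close> up to sign. The factor 3 clears the denominator of the
  closed form; this sum serves the case \<open>p = 3\<close>.\<close>

lemma sum_binomial_super_shift:
  "3 * (\<Sum>k\<le>m. ibinom (int (Suc (Suc m))) k * super_catalan (m - k) (Suc k))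
     = (int m + 1) * (2 * int m + 3) * cbin (Suc m)"
proof -
  have m2: "ibinom (- 2) k = (- 1) ^ k * (int k + 1)" for k
    using ibinom_negated_upper[of "-2" k] ibinom_Suc_n[of k]
    by (simp add: add.commute)
  have "(\<Sum>k\<le>m. ibinom (int (Suc (Suc m))) k * super_catalan (m - k) (Suc k) )
      = (\<Sum>k\<le>m. ibinom (- 2) k * (- 1) ^ k * cbin (Suc k) * 4 ^ (m - k))"
    using gbinomial_partial_sum_mixed[of m "- int (Suc (Suc m))" 1 "\<lambda>k. cbin (Suc k)"]
    by (simp add: super_catalan_def mixed_shift add.commute)
  also have "\<dots> = (\<Sum>k\<le>m. (int k + 1) * cbin (Suc k) * 4 ^ (m - k))"
    by (intro sum.cong) (simp_all add: m2 mult_ac flip: power_mult_distrib)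
  finally show ?thesis by (simp only: sum_index_cbin)
qed

section \<open>Prime powers dividing single terms\<close>

text \<open>Since \<open>u < p ^ Suc t\<close>, the multiplicity of \<open>p\<close> in
  \<open>u\<close> is at most \<open>t\<close>, and the rest of \<open>u\<close> is coprime to
  \<open>p\<close>.\<close>

lemma pow_dvd_trade:
  fixes p u x :: int
  assumes p: "prime p" and u: "0 < u" "u < p ^ Suc t" and d: "p ^ a dvd u * x"
  shows "p ^ a dvd p ^ t * x"
proof -
  from p u have "\<not> is_unit p" "u \<noteq> 0" by auto
  then obtain r where r: "u = p ^ multiplicity p u * r" "\<not> p dvd r"
    by (metis multiplicity_decompose')
  have "p ^ multiplicity p u < p ^ Suc t"
    using u zdvd_imp_le[OF multiplicity_dvd[of p u] u(1)] by linarith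
  then have "multiplicity p u \<le> t"
    using p prime_gt_1_int[of p] power_less_imp_less_exp[of p] by (metis less_Suc_eq_le)
  moreover have "coprime (p ^ a) r"
    using p r(2) by (simp add: prime_imp_coprime)
  then have "p ^ a dvd p ^ multiplicity p u * x"
    using d r(1) by (metis coprime_dvd_mult_right_iff mult.assoc mult.commute)
  ultimately show ?thesis
    by (meson dvd_trans le_imp_power_dvd mult_dvd_mono dvd_refl)
qed

lemma pow_dvd_super:
  fixes p :: int
  assumes "prime p" "odd p" "p ^ a dvd int k + int j + 1"
  shows "p ^ a dvd (2 * int k + 1) * super_catalan j k"
proof -
  have "p ^ a dvd 2 * ((2 * int k + 1) * super_catalan j k)"
    using super_catalan_right[of k j] assms(3) by (metis dvd_mult2 mult.assoc)
  moreover have "coprime (p ^ a) 2"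
    using assms by simp
  ultimately show ?thesis by (simp add: coprime_dvd_mult_right_iff)
qed

text \<open>Write 2i + 1 = (2(k + i) + 1) - 2k. The first part is handled by
  \<open>pow_dvd_super\<close>, because (k + i) + (j - i) + 1 = k + j + 1; the second by the
  hypothesis on \<open>int k * c\<close>.\<close>

lemma pow_dvd_mult_super:
  fixes p c :: int
  assumes p: "prime p" "odd p" and n: "p ^ a dvd int k + int j + 1" and c: "p ^ a dvd int k * c"
    and i: "i \<le> j"
  shows "p ^ a dvd (2 * int i + 1) * (c * super_catalan (j - i) (k + i))"
proof -
  have "p ^ a dvd (2 * int (k + i) + 1) * super_catalan (j - i) (k + i)"
    using pow_dvd_super[OF p, of a "k + i" "j - i"] n i by (simp add: of_nat_diff)
  then have "p ^ a dvd c * ((2 * int (k + i) + 1) * super_catalan (j - i) (k + i)) - (int k * c) * (2 * super_catalan (j - i) (k + i))"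
    using c by (intro dvd_diff) auto
  also have "c * ((2 * int (k + i) + 1) * super_catalan (j - i) (k + i)) - (int k * c) * (2 * super_catalan (j - i) (k + i))
     = (2 * int i + 1) * (c * super_catalan (j - i) (k + i))"
    by (simp add: algebra_simps)
  finally show ?thesis .
qed

text \<open>The same splitting of 2i + 1; \<open>c\<close> itself supplies the additional factor
  \<open>p\<close> in the first part.\<close>

lemma pow_Suc_dvd_mult_super:
  fixes p c :: int
  assumes p: "prime p" "odd p" and n: "p ^ a dvd int k + int j + 1" and c: "p ^ Suc a dvd int k * c"
    and pc: "p dvd c" and i: "i \<le> j"
  shows "p ^ Suc a dvd (2 * int i + 1) * (c * super_catalan (j - i) (k + i))"
proof -
  have "p ^ a dvd (2 * int (k + i) + 1) * super_catalan (j - i) (k + i)"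
    using pow_dvd_super[OF p, of a "k + i" "j - i"] n i by (simp add: of_nat_diff)
  then have "p ^ Suc a dvd c * ((2 * int (k + i) + 1) * super_catalan (j - i) (k + i))"
    using pc by (simp add: mult_dvd_mono)
  then have "p ^ Suc a dvd c * ((2 * int (k + i) + 1) * super_catalan (j - i) (k + i)) - (int k * c) * (2 * super_catalan (j - i) (k + i))"
    using c by (intro dvd_diff) auto
  also have "c * ((2 * int (k + i) + 1) * super_catalan (j - i) (k + i)) - (int k * c) * (2 * super_catalan (j - i) (k + i))
     = (2 * int i + 1) * (c * super_catalan (j - i) (k + i))"
    by (simp add: algebra_simps)
  finally show ?thesis .
qed

lemma index_less_pow3: "2 * int i + 1 < 3 ^ Suc i"
  by (induction i) auto

text \<open>The excluded case is the equality 2 * 1 + 1 = 3 ^ 1.\<close>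

lemma index_less_odd_pow:
  fixes p :: int
  assumes a: "i \<noteq> 0" "3 \<le> p" "odd p" "\<not> (p = 3 \<and> i = 1)"
  shows "2 * int i + 1 < p ^ i"
proof (cases "i = 1")
  case True
  then show ?thesis using a by auto
next
  case False
  then have "2 \<le> i" using a by simp
  then have "2 * int i + 1 < 3 ^ i"
    by (induction i rule: dec_induct) auto
  also have "\<dots> \<le> p ^ i" using a by (intro power_mono) auto
  finally show ?thesis .
qed

lemma pow_dvd_pow_mult_super:
  fixes p c :: int
  assumes p: "prime p" "odd p" and n: "p ^ a dvd int k + int j + 1" and c: "p ^ a dvd int k * c"
    and i: "i \<le> j"
  shows "p ^ a dvd p ^ i * (c * super_catalan (j - i) (k + i))"
proof (rule pow_dvd_trade[OF p(1) _ _ pow_dvd_mult_super[OF p n c i]])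
  have "p \<ge> 3" using p prime_ge_2_int[of p] by (cases "p = 2") auto
  then have "(3::int) ^ Suc i \<le> p ^ Suc i" by (intro power_mono) auto
  with index_less_pow3[of i] show "2 * int i + 1 < p ^ Suc i" by linarith
qed simp

text \<open>Outside the exception, 2i + 1 costs only \<open>p ^ (i - 1)\<close>, so one factor of
  \<open>p ^ i\<close> is left over.\<close>

lemma pow_Suc_dvd_pow_mult_super:
  fixes p c :: int
  assumes p: "prime p" "odd p" and n: "p ^ a dvd int k + int j + 1" and c: "p ^ a dvd int k * c"
    and i: "i \<le> j" "i \<noteq> 0" and ex: "\<not> (p = 3 \<and> i = 1)"
  shows "p ^ Suc a dvd p ^ i * (c * super_catalan (j - i) (k + i))"
proof -
  obtain t where t: "i = Suc t" using i(2) by (cases i) auto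
  have "p \<ge> 3" using p prime_ge_2_int[of p] by (cases "p = 2") auto
  then have "2 * int i + 1 < p ^ Suc t"
    using index_less_odd_pow[of i p] i ex p t by auto
  then have "p ^ a dvd p ^ t * (c * super_catalan (j - i) (k + i))"
    by (intro pow_dvd_trade[OF p(1) _ _ pow_dvd_mult_super[OF p n c i(1)]]) auto
  then show ?thesis using t by (simp add: mult.assoc)
qed

section \<open>Dependence of C(xn, k) on x\<close>

lemma pow_dvd_index_mult_ibinom:
  fixes p n :: int
  assumes "p ^ a dvd n"
  shows "p ^ a dvd int k * ibinom (x * n) k"
proof (cases k)
  case (Suc l)
  have "int k * ibinom (x * n) k = x * n * ibinom (x * n - 1) l"
    using ibinom_absorb[of l "x * n"] Suc by (simp add: add.commute)
  then show ?thesis using assms by simp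
qed simp

lemma prime_dvd_ibinom:
  fixes p :: int
  assumes p: "prime p" and k: "0 < k" "int k < p ^ a"
  shows "p dvd ibinom (x * p ^ a) k"
proof (rule ccontr)
  assume "\<not> p dvd ibinom (x * p ^ a) k"
  then have "coprime (p ^ a) (ibinom (x * p ^ a) k)"
    using p by (simp add: prime_imp_coprime)
  then have "p ^ a dvd int k"
    using pow_dvd_index_mult_ibinom[OF dvd_refl, of p a k x] by (simp add: coprime_dvd_mult_left_iff)
  then show False using k zdvd_imp_le[of "p ^ a" "int k"] by simp
qed

text \<open>By Pascal's rule, each step in \<open>k\<close> flips the sign up to a coefficient C(x
  p^a, k), which \<open>p\<close> divides.\<close>

lemma ibinom_pred_cong:
  fixes p :: int
  assumes p: "prime p" and k: "int k < p ^ a"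
  shows "p dvd ibinom (x * p ^ a - 1) k - (- 1) ^ k"
  using k
proof (induction k)
  case (Suc k)
  have "ibinom (x * p ^ a - 1) (Suc k) - (- 1) ^ Suc k
      = ibinom (x * p ^ a) (Suc k) - (ibinom (x * p ^ a - 1) k - (- 1) ^ k)"
    using ibinom_Suc_Suc[of "x * p ^ a - 1" k] by simp
  moreover have "p dvd ibinom (x * p ^ a) (Suc k)"
    using prime_dvd_ibinom[OF p] Suc.prems by blast
  ultimately show ?case using Suc by (simp del: power_Suc)
qed simp

text \<open>Absorption gives k C(y p^a, k) = y p^a C(y p^a - 1, k - 1), and the last coefficient
  does not depend on \<open>y\<close> modulo \<open>p\<close>. The two conclusions are what
  \<open>pow_Suc_dvd_mult_super\<close> asks of its \<open>c\<close>.\<close>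

lemma ibinom_linear:
  fixes p x :: int
  assumes p: "prime p" and k: "0 < k" "int k < p ^ a"
  defines "d \<equiv> ibinom (x * p ^ a) k - x * ibinom (p ^ a) k"
  shows "p dvd d" "p ^ Suc a dvd int k * d"
proof -
  show "p dvd d"
    using prime_dvd_ibinom[OF p k, of x] prime_dvd_ibinom[OF p k, of 1] by (simp add: d_def)
  obtain l where l: "k = Suc l" using k by (cases k) auto
  have *: "int k * ibinom (y * p ^ a) k = y * p ^ a * ibinom (y * p ^ a - 1) l" for y
    using ibinom_absorb[of l "y * p ^ a"] l by (simp add: add.commute)
  have "int k * d = p ^ a * (x * (ibinom (x * p ^ a - 1) l - ibinom (1 * p ^ a - 1) l))"
    using *[of x] *[of 1] unfolding d_def by (simp add: algebra_simps)
  moreover have "int l < p ^ a" using k l by simp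
  then have "p dvd ibinom (x * p ^ a - 1) l - ibinom (1 * p ^ a - 1) l"
    using dvd_diff[OF ibinom_pred_cong[OF p, of l a x] ibinom_pred_cong[OF p, of l a 1]] by simp
  ultimately show "p ^ Suc a dvd int k * d"
    by (simp add: mult_dvd_mono mult.commute[of p])
qed

section \<open>The estimate for general n\<close>

text \<open>After \<open>mixed_change\<close> every term is divisible on its own, since
  \<open>(1 - g) ^ i\<close> provides the \<open>p ^ i\<close> needed in
  \<open>pow_dvd_pow_mult_super\<close>.\<close>

lemma pow_dvd_weighted_sum:
  fixes p :: int
  assumes p: "prime p" "odd p" and n: "p ^ a dvd int m + 1" and g: "p dvd 1 - g"
  shows "p ^ a dvd (\<Sum>k\<le>m. ibinom (x * (int m + 1)) k * g ^ k * mixed g cbin (m - k) k)"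
proof (rule dvd_sum)
  fix k assume k: "k \<in> {..m}"
  let ?c = "ibinom (x * (int m + 1)) k"
  have summand: "p ^ a dvd (1 - g) ^ i * (?c * super_catalan (m - k - i) (k + i))" if i: "i \<le> m - k" for i
  proof -
    have "p ^ a dvd p ^ i * (?c * super_catalan (m - k - i) (k + i))"
      using n k by (intro pow_dvd_pow_mult_super[OF p _ pow_dvd_index_mult_ibinom[OF n] i]) (simp add: of_nat_diff)
    moreover have "p ^ i dvd (1 - g) ^ i" using g by (rule dvd_power_same)
    ultimately show ?thesis by (meson dvd_trans mult_dvd_mono dvd_refl)
  qed
  have "p ^ a dvd (\<Sum>i\<le>m - k. int (m - k choose i) * g ^ k * ((1 - g) ^ i * (?c * super_catalan (m - k - i) (k + i))))"
    by (rule dvd_sum, rule dvd_mult, rule summand) simp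
  also have "\<dots> = ?c * g ^ k * mixed g cbin (m - k) k"
    by (subst mixed_change) (simp add: super_catalan_def sum_distrib_left mult_ac)
  finally show "p ^ a dvd ?c * g ^ k * mixed g cbin (m - k) k" .
qed

section \<open>The refinement modulo p^(a+1) for n = p^a\<close>

text \<open>In the expansion by \<open>mixed_change\<close>, only \<open>i = 0\<close> and
  \<open>i = 1\<close> survive, the latter possibly only for \<open>p = 3\<close>. Their
  coefficients simplify because \<open>1 + q\<close> is 1 and \<open>m\<close> is -1 modulo
  \<open>p\<close>.\<close>

lemma mixed_linear_cong:
  fixes p c :: int
  assumes p: "prime p" "odd p" and a: "0 < a" and n: "int m + 1 = p ^ a" and q: "p dvd q"
    and k: "k \<le> m" and c: "p ^ a dvd int k * c"
  shows "p ^ Suc a dvd c * (1 + q) ^ k * mixed (1 + q) cbin (m - k) k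
           - (c * super_catalan (m - k) k + (if k < m then q * (c * super_catalan (m - Suc k) (Suc k)) else 0))"
proof -
  let ?t = "\<lambda>i. c * (1 + q) ^ k * (int (m - k choose i) * (- q) ^ i * super_catalan (m - k - i) (k + i))"
  have nk: "p ^ a dvd int k + int (m - k) + 1" using n k by (simp add: of_nat_diff)
  have gk: "p dvd (1 + q) ^ k - 1"
  proof -
    have "[1 + q = 1] (mod p)" using q by (simp add: cong_iff_dvd_diff)
    then have "[(1 + q) ^ k = 1 ^ k] (mod p)" by (rule cong_pow)
    then show ?thesis by (simp add: cong_iff_dvd_diff)
  qed
  have expand: "c * (1 + q) ^ k * mixed (1 + q) cbin (m - k) k = (\<Sum>i\<le>m - k. ?t i)"
    by (subst mixed_change) (simp add: super_catalan_def sum_distrib_left)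
  have high: "p ^ Suc a dvd ?t i" if "i \<le> m - k" "i \<noteq> 0" "\<not> (p = 3 \<and> i = 1)" for i
  proof -
    have "p ^ Suc a dvd p ^ i * (c * super_catalan (m - k - i) (k + i))"
      using that by (intro pow_Suc_dvd_pow_mult_super[OF p nk c]) auto
    moreover have "p ^ i dvd (- q) ^ i" using q by (intro dvd_power_same) simp
    ultimately have "p ^ Suc a dvd (- q) ^ i * (c * super_catalan (m - k - i) (k + i))"
      by (meson dvd_trans mult_dvd_mono dvd_refl)
    then have "p ^ Suc a dvd ((1 + q) ^ k * int (m - k choose i)) * ((- q) ^ i * (c * super_catalan (m - k - i) (k + i)))"
      by (rule dvd_mult)
    also have "\<dots> = ?t i" by (simp only: mult_ac)
    finally show ?thesis .
  qed
  have zero: "p ^ Suc a dvd ?t 0 - c * super_catalan (m - k) k"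
  proof -
    have "p ^ a dvd c * super_catalan (m - k) k"
      using pow_dvd_pow_mult_super[OF p nk c, of 0] by simp
    then have "p ^ Suc a dvd ((1 + q) ^ k - 1) * (c * super_catalan (m - k) k)"
      using gk by (simp add: mult_dvd_mono)
    also have "\<dots> = ?t 0 - c * super_catalan (m - k) k" by (simp add: algebra_simps)
    finally show ?thesis .
  qed
  have one: "p ^ Suc a dvd ?t 1 - q * (c * super_catalan (m - Suc k) (Suc k))" if "k < m"
  proof -
    let ?y = "c * super_catalan (m - Suc k) (Suc k)"
    \<comment> \<open>This product is the negative of the difference to be estimated. For
      \<open>p\<close> other than 3 already \<open>p * ?y\<close> is divisible.\<close>
    have "p ^ Suc a dvd q * ((1 + q) ^ k * int (m - k) + 1) * ?y"
    proof (cases "p = 3")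
      case False
      then have "p ^ Suc a dvd p * ?y"
        using pow_Suc_dvd_pow_mult_super[OF p nk c, of 1] that by simp
      also have "\<dots> dvd q * ((1 + q) ^ k * int (m - k) + 1) * ?y"
        using q by (intro mult_dvd_mono) auto
      finally show ?thesis .
    next
      case 3: True
      show ?thesis
      proof (cases "p dvd int k")
        case True
        have "p ^ a dvd p * ?y"
          using pow_dvd_pow_mult_super[OF p nk c, of 1] that by simp
        \<comment> \<open>Here \<open>k\<close> is 0 modulo \<open>p\<close>, so
          \<open>m - k\<close> is -1 and the bracket supplies the missing factor
          \<open>p\<close>.\<close>
        moreover have "p dvd (1 + q) ^ k * int (m - k) + 1"
        proof -
          have "p dvd int m + 1" using n a by simp
          then have "p dvd ((1 + q) ^ k - 1) * int (m - k) + (int m + 1) - int k"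
            using dvd_diff[OF dvd_add[OF dvd_mult2[OF gk]] True] by blast
          also have "\<dots> = (1 + q) ^ k * int (m - k) + 1"
            using k by (simp add: of_nat_diff algebra_simps)
          finally show ?thesis .
        qed
        ultimately have "p ^ a * p dvd (p * ?y) * ((1 + q) ^ k * int (m - k) + 1)"
          by (rule mult_dvd_mono)
        also have "\<dots> dvd (q * ?y) * ((1 + q) ^ k * int (m - k) + 1)"
          using q by (intro mult_dvd_mono) auto
        finally show ?thesis by (simp add: mult_ac)
      next
        case False
        \<comment> \<open>With \<open>k\<close> prime to \<open>p\<close>, all of
          \<open>p ^ a\<close> divides \<open>c\<close>, and \<open>q\<close> gives one more
          factor.\<close>
        then have "coprime (p ^ a) (int k)" using p by (simp add: prime_imp_coprime)
        then have "p ^ a dvd c" using c by (simp add: coprime_dvd_mult_right_iff)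
        with q have "p * p ^ a dvd q * c" by (intro mult_dvd_mono)
        then have "p ^ Suc a dvd q * c * (((1 + q) ^ k * int (m - k) + 1) * super_catalan (m - Suc k) (Suc k))"
          by simp
        then show ?thesis by (simp only: mult_ac)
      qed
    qed
    then have "p ^ Suc a dvd - (q * ((1 + q) ^ k * int (m - k) + 1) * ?y)"
      by simp
    also have "\<dots> = ?t 1 - q * ?y"
      by (simp add: algebra_simps)
    finally show ?thesis .
  qed
  show ?thesis
  proof (cases "k < m")
    case False
    then show ?thesis using zero k by (simp add: expand super_catalan_0)
  next
    case True
    then have "{..m - k} = insert 0 (insert 1 {2..m - k})" by auto
    then have "c * (1 + q) ^ k * mixed (1 + q) cbin (m - k) k = ?t 0 + ?t 1 + (\<Sum>i\<in>{2..m - k}. ?t i)"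
      unfolding expand by simp
    moreover have "p ^ Suc a dvd (\<Sum>i\<in>{2..m - k}. ?t i)"
      by (intro dvd_sum high) auto
    from dvd_add[OF dvd_add[OF zero one[OF True]] this]
    have "p ^ Suc a dvd ?t 0 + ?t 1 + (\<Sum>i\<in>{2..m - k}. ?t i)
        - (c * super_catalan (m - k) k + q * (c * super_catalan (m - Suc k) (Suc k)))"
      by (simp only: diff_conv_add_uminus minus_add_distrib add_ac)
    ultimately show ?thesis using True by (simp only: if_True)
  qed
qed

text \<open>The term at index 0 does not vary with \<open>x\<close>, so the sum is affine in
  \<open>x\<close>: \<open>w 0\<close> is its value at 0 and the sum over \<open>b'\<close> its
  value at 1.\<close>

lemma sum_linear_cong:
  fixes b b' w :: "nat \<Rightarrow> int"
  assumes "\<And>k. 0 < k \<Longrightarrow> k \<le> m \<Longrightarrow> P dvd (b k - x * b' k) * w k" and "b 0 = 1" "b' 0 = 1"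
  shows "P dvd (\<Sum>k\<le>m. b k * w k) - (w 0 + x * ((\<Sum>k\<le>m. b' k * w k) - w 0))"
proof -
  have s: "(\<Sum>k\<le>m. f k) = f 0 + (\<Sum>k\<in>{1..m}. f k)" for f :: "nat \<Rightarrow> int"
  proof -
    have "{..m} = insert 0 {1..m}" by auto
    then show ?thesis by simp
  qed
  have "P dvd (\<Sum>k\<in>{1..m}. (b k - x * b' k) * w k)"
    using assms by (intro dvd_sum) auto
  then show ?thesis
    unfolding s using assms by (simp add: algebra_simps sum_subtractf sum_distrib_left)
qed

lemma pow_dvd_cbin:
  fixes p :: int
  assumes p: "prime p" "odd p" and n: "int m + 1 = p ^ a"
  shows "p ^ a dvd cbin m"
  using pow_dvd_super[OF p, of a 0 m] n by (simp add: super_catalan_0_right)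

text \<open>The sum is affine in \<open>x\<close> with values B at 0 and W at 1, and 2(B + x(W - B))
  = (B + W) + (2x - 1)(W - B). The last product gains a factor \<open>p\<close> from
  \<open>2 * x - 1\<close>, and B + W = 2(m + 1)B.\<close>

lemma constant_sum_cong:
  fixes p :: int
  assumes p: "prime p" "odd p" and a: "0 < a" and n: "int m + 1 = p ^ a" and x: "p dvd 2 * x - 1"
  shows "p ^ Suc a dvd (\<Sum>k\<le>m. ibinom (x * p ^ a) k * super_catalan (m - k) k)"
proof -
  let ?T = "\<Sum>k\<le>m. ibinom (x * p ^ a) k * super_catalan (m - k) k"
  let ?B = "cbin m" let ?W = "(2 * int m + 1) * ?B"
  have B: "p ^ a dvd ?B" using pow_dvd_cbin[OF p n] .
  have "p ^ Suc a dvd ?T - (super_catalan (m - 0) 0 + x * ((\<Sum>k\<le>m. ibinom (p ^ a) k * super_catalan (m - k) k) - super_catalan (m - 0) 0))"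
  proof (rule sum_linear_cong)
    fix k assume k: "0 < k" "k \<le> m"
    then have "int k < p ^ a" using n by simp
    note lin = ibinom_linear[OF p(1) k(1) this, of x]
    have "p ^ a dvd int k + int (m - k) + 1" using n k by (simp add: of_nat_diff)
    from pow_Suc_dvd_mult_super[OF p this lin(2,1), of 0]
    show "p ^ Suc a dvd (ibinom (x * p ^ a) k - x * ibinom (p ^ a) k) * super_catalan (m - k) k"
      by simp
  qed simp_all
  also have "(\<Sum>k\<le>m. ibinom (p ^ a) k * super_catalan (m - k) k) = ?W"
    using sum_binomial_super[of m] n by (simp add: add.commute)
  finally have "p ^ Suc a dvd 2 * (?T - (?B + x * (?W - ?B)))"
    by (intro dvd_mult) (simp add: super_catalan_0_right)
  moreover have "p ^ Suc a dvd (2 * x - 1) * (?W - ?B)"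
    using B x by (simp add: mult_dvd_mono)
  moreover have "p ^ Suc a dvd ?B + ?W"
  proof -
    have "?B + ?W = (p ^ a * ?B) * 2" unfolding n[symmetric] by (simp add: algebra_simps)
    moreover have "p ^ Suc a dvd p ^ a * ?B"
      using B a by (metis dvd_trans dvd_refl mult.commute mult_dvd_mono power_Suc dvd_power)
    ultimately show ?thesis by simp
  qed
  ultimately have "p ^ Suc a dvd 2 * (?T - (?B + x * (?W - ?B))) + (2 * x - 1) * (?W - ?B) + (?B + ?W)"
    using dvd_add[OF dvd_add] by blast
  also have "\<dots> = 2 * ?T" by (simp add: algebra_simps)
  finally show ?thesis
    using p by (simp add: coprime_dvd_mult_right_iff del: power_Suc)
qed

text \<open>The argument of \<open>constant_sum_cong\<close> for values 3U at 0 and 3W at 1. Here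
  \<open>U\<close> carries the denominator 2M + 1, which is divisible by 3 exactly once as
  \<open>a > 1\<close>.\<close>

lemma shifted_combination_dvd:
  fixes B U V W M x :: int
  assumes a: "1 < a" and M: "M + 2 = 3 ^ a" and x: "3 dvd 2 * x - 1" and B: "3 ^ a dvd B"
    and U: "(2 * M + 1) * U = B" and W: "3 * W = (M + 1) * (2 * M + 3) * B"
    and V: "3 ^ Suc a dvd V - (3 * U + x * (3 * W - 3 * U))"
  shows "3 ^ Suc a dvd V"
proof -
  obtain b where b: "a = Suc (Suc b)"
    using a less_iff_Suc_add[of 1 a] by auto
  define r :: int where "r = 6 * 3 ^ b - 1"
  have r: "2 * M + 1 = 3 * r" using M b by (simp add: r_def)
  have "coprime (3 ^ Suc a) r"
  proof -
    have "\<not> 3 dvd 6 * t - (1::int)" for t by presburger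
    then have "\<not> 3 dvd r" by (simp add: r_def)
    then have "coprime 3 r" by (intro prime_imp_coprime) simp_all
    then show ?thesis by simp
  qed
  moreover have "3 ^ Suc a dvd r * (3 * U + 3 * W)"
  proof -
    have "(2 * M + 1) * (3 * U + 3 * W) = 3 * ((2 * M + 1) * U) + (2 * M + 1) * (3 * W)"
      by (simp add: algebra_simps)
    \<comment> \<open>The cubic in \<open>M\<close> multiplying \<open>B\<close> has the factor M +
      2 = 3^a.\<close>
    also have "\<dots> = (3 ^ a * B) * (4 * M ^ 2 + 4 * M + 3)"
      unfolding U W M[symmetric] by (simp add: algebra_simps power2_eq_square)
    finally have "3 * (r * (3 * U + 3 * W)) = (3 ^ a * B) * (4 * M ^ 2 + 4 * M + 3)"
      unfolding r by (simp only: mult.assoc)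
    moreover have "3 ^ a * 3 ^ a dvd 3 ^ a * B" using B by (intro mult_dvd_mono) auto
    ultimately have "3 ^ a * 3 ^ a dvd 3 * (r * (3 * U + 3 * W))" by (metis dvd_mult2)
    moreover have "3 ^ a * 3 ^ a = 3 * (3 ^ Suc a * (3::int) ^ b)" by (simp add: b)
    ultimately have "3 ^ Suc a * 3 ^ b dvd r * (3 * U + 3 * W)" by (simp only: dvd_mult_cancel_left) simp
    then show ?thesis by (rule dvd_mult_left)
  qed
  ultimately have UW: "3 ^ Suc a dvd 3 * U + 3 * W"
    by (simp only: coprime_dvd_mult_right_iff)
  \<comment> \<open>The difference 3W - 3U is treated as 2(3W) - (3U + 3W), whose parts are under
    control.\<close>
  have "3 ^ a dvd 3 * W" unfolding W using B by (rule dvd_mult)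
  moreover have "3 ^ a dvd 3 * U + 3 * W" using UW by (rule power_le_dvd) simp
  ultimately have "3 ^ a dvd 2 * (3 * W) - (3 * U + 3 * W)"
    by (rule dvd_diff[OF dvd_mult])
  with x have "3 * 3 ^ a dvd (2 * x - 1) * (2 * (3 * W) - (3 * U + 3 * W))"
    by (rule mult_dvd_mono)
  then have 1: "3 ^ Suc a dvd (2 * x - 1) * (2 * (3 * W) - (3 * U + 3 * W))"
    by simp
  have "3 ^ Suc a dvd 2 * (V - (3 * U + x * (3 * W - 3 * U)))
      + (2 * x - 1) * (2 * (3 * W) - (3 * U + 3 * W)) + (3 * U + 3 * W)"
    by (rule dvd_add[OF dvd_add[OF dvd_mult[OF V] 1] UW])
  also have "\<dots> = 2 * V" by (simp add: algebra_simps)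
  finally show ?thesis
    by (simp add: coprime_dvd_mult_right_iff del: power_Suc)
qed

text \<open>This bounds the \<open>i = 1\<close> contributions for \<open>p = 3\<close>. They stop
  one index earlier, hence \<open>m + 2\<close> in place of \<open>m + 1\<close>.\<close>

lemma shifted_sum_cong:
  fixes x :: int
  assumes a: "1 < a" and n: "int m + 2 = 3 ^ a" and x: "3 dvd 2 * x - 1"
  shows "3 ^ Suc a dvd 3 * (\<Sum>k\<le>m. ibinom (x * 3 ^ a) k * super_catalan (m - k) (Suc k))"
proof -
  have p: "prime (3::int)" "odd (3::int)" by simp_all
  let ?V = "\<Sum>k\<le>m. ibinom (x * 3 ^ a) k * super_catalan (m - k) (Suc k)"
  let ?W = "\<Sum>k\<le>m. ibinom (3 ^ a) k * super_catalan (m - k) (Suc k)"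
  let ?B = "cbin (Suc m)" and ?U = "super_catalan m 1"
  have B: "3 ^ a dvd ?B" using pow_dvd_cbin[OF p, of "Suc m" a] n by (simp add: add.commute)
  have U: "(2 * int m + 1) * ?U = ?B"
  proof -
    have "(int m + 1) * ((2 * int m + 1) * super_catalan m 1) = (int m + 1) * super_catalan (Suc m) 0"
      using super_catalan_right[of 0 m] super_catalan_left[of 0 m] by (simp add: algebra_simps)
    then show ?thesis by (simp add: super_catalan_0_right)
  qed
  have W: "3 * ?W = (int m + 1) * (2 * int m + 3) * ?B"
    using sum_binomial_super_shift[of m] n by (simp add: add.commute)
  have main: "3 ^ Suc a dvd 3 * ?V - (3 * super_catalan (m - 0) (Suc 0) + x * (3 * ?W - 3 * super_catalan (m - 0) (Suc 0)))"
  proof -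
    have "3 ^ Suc a dvd (\<Sum>k\<le>m. ibinom (x * 3 ^ a) k * (3 * super_catalan (m - k) (Suc k)))
       - (3 * super_catalan (m - 0) (Suc 0) + x * ((\<Sum>k\<le>m. ibinom (3 ^ a) k * (3 * super_catalan (m - k) (Suc k))) - 3 * super_catalan (m - 0) (Suc 0)))"
    proof (rule sum_linear_cong)
      fix k assume k: "0 < k" "k \<le> m"
      then have "int k < 3 ^ a" using of_nat_mono[OF k(2), where 'a = int] n by linarith
      note lin = ibinom_linear[OF p(1) k(1) this, of x]
      have "3 ^ a dvd int k + int (Suc m - k) + 1" using k by (simp add: n[symmetric] of_nat_diff add.commute)
      \<comment> \<open>The factor 2i + 1 equals 3 at \<open>i = 1\<close>; it is the 3 put into the
        weights.\<close>
      from pow_Suc_dvd_mult_super[OF p this lin(2,1), of 1] k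
      show "3 ^ Suc a dvd (ibinom (x * 3 ^ a) k - x * ibinom (3 ^ a) k) * (3 * super_catalan (m - k) (Suc k))"
        by (simp add: mult_ac)
    qed simp_all
    moreover have "(\<Sum>k\<le>m. b k * (3 * w k)) = 3 * (\<Sum>k\<le>m. b k * w k)" for b w :: "nat \<Rightarrow> int"
      by (simp add: sum_distrib_left mult_ac)
    ultimately show ?thesis by (simp only:)
  qed
  have "3 ^ Suc a dvd 3 * ?V - (3 * ?U + x * (3 * ?W - 3 * ?U))"
    using main by simp
  from shifted_combination_dvd[OF a n x B U W this] show ?thesis .
qed

lemma pow_Suc_dvd_weighted_sum:
  fixes p :: int
  assumes p: "prime p" "odd p" and a: "0 < a" and p3: "3 < p ^ a" and n: "int m + 1 = p ^ a"
    and q: "p dvd q" and x: "p dvd 2 * x - 1"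
  shows "p ^ Suc a dvd (\<Sum>k\<le>m. ibinom (x * p ^ a) k * (1 + q) ^ k * mixed (1 + q) cbin (m - k) k)"
proof -
  let ?c = "\<lambda>k. ibinom (x * p ^ a) k"
  let ?u = "\<lambda>k. q * (?c k * super_catalan (m - Suc k) (Suc k))"
  have c: "p ^ a dvd int k * ?c k" for k
    by (rule pow_dvd_index_mult_ibinom) simp
  obtain l where l: "m = Suc l" using n p3 by (cases m) auto
  have u: "(\<Sum>k\<le>m. if k < m then ?u k else 0) = (\<Sum>k\<le>l. ?u k)"
    unfolding l by (simp add: less_Suc_eq_le)
  have "p ^ Suc a dvd (\<Sum>k\<le>m. ?c k * (1 + q) ^ k * mixed (1 + q) cbin (m - k) k
           - (?c k * super_catalan (m - k) k + (if k < m then ?u k else 0)))"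
    by (intro dvd_sum mixed_linear_cong[OF p a n q _ c]) auto
  then have 1: "p ^ Suc a dvd (\<Sum>k\<le>m. ?c k * (1 + q) ^ k * mixed (1 + q) cbin (m - k) k)
           - ((\<Sum>k\<le>m. ?c k * super_catalan (m - k) k) + (\<Sum>k\<le>l. ?u k))"
    by (simp only: sum_subtractf sum.distrib u)
  have 2: "p ^ Suc a dvd (\<Sum>k\<le>m. ?c k * super_catalan (m - k) k)"
    by (rule constant_sum_cong[OF p a n x])
  have 3: "p ^ Suc a dvd (\<Sum>k\<le>l. ?u k)"
  proof (cases "p = 3")
    case True
    \<comment> \<open>For \<open>p = 3\<close> the bound \<open>3 < p ^ a\<close> means
      \<open>a > 1\<close>, as \<open>shifted_sum_cong\<close> requires; the factor 3 there comes
      from \<open>q\<close>.\<close>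
    have "a \<noteq> 1" using p3 True by auto
    then have "p ^ Suc a dvd p * (\<Sum>k\<le>l. ?c k * super_catalan (l - k) (Suc k))"
      using shifted_sum_cong[of a l x] n x a True l by (simp add: add.commute)
    also have "\<dots> dvd q * (\<Sum>k\<le>l. ?c k * super_catalan (l - k) (Suc k))"
      using q by (intro mult_dvd_mono) auto
    finally show ?thesis by (simp add: l sum_distrib_left)
  next
    case False
    show ?thesis
    proof (rule dvd_sum)
      fix k assume k: "k \<in> {..l}"
      have "p ^ a dvd int k + int (m - k) + 1" using n k l by (simp add: of_nat_diff)
      then have "p ^ Suc a dvd p * (?c k * super_catalan (m - Suc k) (Suc k))"
        using pow_Suc_dvd_pow_mult_super[OF p _ c, of k "m - k" 1] k l False by simp
      also have "\<dots> dvd ?u k" using q by (intro mult_dvd_mono) auto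
      finally show "p ^ Suc a dvd ?u k" .
    qed
  qed
  from dvd_add[OF 1 dvd_add[OF 2 3]] show ?thesis by simp
qed

section \<open>Return to the rational sums\<close>

text \<open>The partial sum identity at \<open>g = 2 * h\<close> and
  \<open>a = (h - 1) * (m + 1)\<close>, where 4(-h/2) = -2h removes the denominators.\<close>

lemma pow4_mult_sum:
  "4 ^ m * (\<Sum>k = 0..m. (of_int (h * (int m + 1) - 1) gchoose k) * of_nat ((2 * k) choose k) * (- (of_int h / 2)) ^ k)
   = rat_of_int (\<Sum>k\<le>m. ibinom ((1 - h) * (int m + 1)) k * (2 * h) ^ k * mixed (2 * h) cbin (m - k) k)"
proof -
  have pow: "4 ^ m * (- (of_int h / 2)) ^ k = (- (2 * rat_of_int h)) ^ k * 4 ^ (m - k)" if "k \<le> m" for k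
  proof -
    have "(4::rat) ^ m = 4 ^ k * 4 ^ (m - k)" using that by (simp flip: power_add)
    then have "4 ^ m * (- (of_int h / 2)) ^ k = (4 * (- (rat_of_int h / 2))) ^ k * 4 ^ (m - k)"
      unfolding power_mult_distrib by simp
    then show ?thesis by simp
  qed
  have upper: "int m + (h - 1) * (int m + 1) = h * (int m + 1) - 1" "- ((h - 1) * (int m + 1)) = (1 - h) * (int m + 1)"
    by (simp_all add: algebra_simps)
  have "4 ^ m * (\<Sum>k = 0..m. (of_int (h * (int m + 1) - 1) gchoose k) * of_nat ((2 * k) choose k) * (- (of_int h / 2)) ^ k)
      = (\<Sum>k\<le>m. rat_of_int (ibinom (h * (int m + 1) - 1) k) * of_nat ((2 * k) choose k) * (4 ^ m * (- (of_int h / 2)) ^ k))"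
    unfolding of_int_ibinom by (simp add: sum_distrib_left atMost_atLeast0 mult_ac)
  also have "\<dots> = rat_of_int (\<Sum>k\<le>m. ibinom (h * (int m + 1) - 1) k * (- (2 * h)) ^ k * cbin k * 4 ^ (m - k))"
    unfolding of_int_sum by (intro sum.cong refl) (simp add: pow cbin_def mult_ac)
  also note gbinomial_partial_sum_mixed[of m "(h - 1) * (int m + 1)" "2 * h" cbin, unfolded upper]
  finally show ?thesis .
qed

text \<open>As \<open>p\<close> is odd, 4^m is a unit at \<open>p\<close>, so \<open>s\<close> and
  \<open>z\<close> have the same valuation.\<close>

lemma
  assumes p: "prime p" "odd p" and s: "4 ^ m * s = rat_of_int z" and z: "int p ^ a dvd z"
  shows nu_ge_of_pow_dvd: "nu p s \<ge> Fin (int a)"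
    and padic_cong_0_of_pow_dvd: "padic_cong p a s 0"
proof -
  have "coprime (int p) 4"
    using p coprime_power_right_iff[of "int p" 2 2] by simp
  then have ndvd: "\<not> int p dvd 4 ^ m"
    using p by (metis coprime_absorb_left coprime_power_right_iff not_prime_unit prime_nat_int_transfer)
  have nu: "nu p t \<ge> Fin (int b)" if "4 ^ m * t = rat_of_int y" "int p ^ b dvd y" for b t y
  proof -
    have "t = Fract y (4 ^ m)"
      using that(1) by (simp add: Fract_of_int_quotient field_simps)
    then have "nu p t = nu_int p y - nu_int p (4 ^ m)"
      using nu_Fract[OF p(1), of "4 ^ m" y] by simp
    moreover have "nu_int p (4 ^ m) = Fin 0"
      using ndvd by (simp add: nu_int_def not_dvd_imp_multiplicity_0)
    moreover have "nu_int p y \<ge> Fin (int b)"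
      using that(2) p by (auto simp: nu_int_def intro!: multiplicity_geI)
    ultimately show ?thesis by (cases "nu_int p y") auto
  qed
  from nu[OF s z] show "nu p s \<ge> Fin (int a)" .
  have pint: "t \<in> padic_integral p" if "4 ^ m * t = rat_of_int y" for t y
    using nu[OF that, of 0] by (simp add: padic_integral_def zero_extended_def)
  \<comment> \<open>The cofactor in the congruence is w / 4^m.\<close>
  obtain w where w: "z = int p ^ a * w" using z by auto
  have "p > 0" using p by (simp add: prime_gt_0_nat)
  then have "4 ^ m * (s / of_nat p ^ a) = rat_of_int w"
    using s w by (simp add: field_simps)
  then have "s / of_nat p ^ a \<in> padic_integral p" by (rule pint)
  moreover have "s - 0 = of_nat p ^ a * (s / of_nat p ^ a)" using \<open>p > 0\<close> by simp
  moreover have "0 \<in> padic_integral p" using pint[of 0 0] by simp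
  ultimately show "padic_cong p a s 0"
    unfolding padic_cong_def using pint[OF s] by blast
qed

theorem theorem1p1:
  fixes p :: nat and h :: int
  assumes "prime p" and "odd p"
    and "[2 * h - 1 = 0] (mod int p)"
  shows "(\<forall>a::nat. a > 0 \<and> p ^ a > 3 \<longrightarrow>
            padic_cong p (a + 1)
              (\<Sum>k = 0..p ^ a - 1. (of_int (h * int (p ^ a) - 1) gchoose k)
                 * of_nat ((2 * k) choose k) * (- (of_int h / 2)) ^ k)
              0)
       \<and> (\<forall>n::nat. n > 0 \<longrightarrow>
            nu p (\<Sum>k = 0..n - 1. (of_int (h * int n - 1) gchoose k)
                 * of_nat ((2 * k) choose k) * (- (of_int h / 2)) ^ k)
              \<ge> nu p (of_nat n))"
proof -
  have p: "prime (int p)" "odd (int p)" using assms by auto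
  have h: "int p dvd 2 * h - 1"
    using assms(3) by (simp add: cong_0_iff)
  have x: "int p dvd 2 * (1 - h) - 1"
  proof -
    have "2 * (1 - h) - 1 = - (2 * h - 1)" by simp
    then show ?thesis using h by (metis dvd_minus_iff)
  qed
  show ?thesis
  proof (intro conjI allI impI)
    fix a :: nat assume a: "a > 0 \<and> p ^ a > 3"
    have n: "int (p ^ a - 1) + 1 = int p ^ a"
      using a by (simp add: of_nat_diff)
    have "3 < int p ^ a" using a by (metis of_nat_less_iff of_nat_numeral of_nat_power)
    \<comment> \<open>Writing 2h as \<open>1 + (2 * h - 1)\<close> exhibits
      \<open>q = 2 * h - 1\<close>.\<close>
    then have "int p ^ Suc a dvd (\<Sum>k\<le>p ^ a - 1. ibinom ((1 - h) * int p ^ a) k * (1 + (2 * h - 1)) ^ k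
        * mixed (1 + (2 * h - 1)) cbin (p ^ a - 1 - k) k)"
      using a by (intro pow_Suc_dvd_weighted_sum[OF p _ _ n h x]) auto
    then show "padic_cong p (a + 1)
              (\<Sum>k = 0..p ^ a - 1. (of_int (h * int (p ^ a) - 1) gchoose k)
                 * of_nat ((2 * k) choose k) * (- (of_int h / 2)) ^ k) 0"
      using padic_cong_0_of_pow_dvd[OF assms(1,2) pow4_mult_sum[of "p ^ a - 1" h], of "Suc a"]
      unfolding n by simp
  next
    fix n :: nat assume n: "n > 0"
    define m where "m = n - 1"
    have m: "int m + 1 = int n" using n by (simp add: m_def of_nat_diff)
    \<comment> \<open>With the exact exponent of \<open>p\<close> in \<open>n\<close>, the general
      estimate becomes the valuation bound.\<close>
    let ?a = "multiplicity (int p) (int n)"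
    have "int p dvd 1 - 2 * h" using h by (simp add: dvd_diff_commute)
    then have "int p ^ ?a dvd (\<Sum>k\<le>m. ibinom ((1 - h) * int n) k * (2 * h) ^ k * mixed (2 * h) cbin (m - k) k)"
      using pow_dvd_weighted_sum[OF p, of ?a m "2 * h" "1 - h"] m by (simp add: multiplicity_dvd)
    from nu_ge_of_pow_dvd[OF assms(1,2) pow4_mult_sum[of m h, unfolded m] this]
    have "Fin (int ?a) \<le> nu p (\<Sum>k = 0..n - 1. (of_int (h * int n - 1) gchoose k)
                 * of_nat ((2 * k) choose k) * (- (of_int h / 2)) ^ k)"
      unfolding m_def .
    moreover have "nu p (of_nat n) = Fin (int ?a)"
      using nu_Fract[OF assms(1), of 1 "int n"] n
      by (simp add: Fract_of_int_quotient nu_int_def)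
    ultimately show "nu p (\<Sum>k = 0..n - 1. (of_int (h * int n - 1) gchoose k)
                 * of_nat ((2 * k) choose k) * (- (of_int h / 2)) ^ k) \<ge> nu p (of_nat n)"
      by simp
  qed
qed

end
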